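(* Let $\mathcal Y,\mathcal X,\mathcal U$ be measurable spaces, $\mathcal W=\mathcal X\times\mathcal U$, and suppose $\mathcal Z=\mathcal Y\times\mathcal X$ is finite with every subset measurable. Let $\theta\in\Theta$ be fixed, let $\Gamma_\theta$ and $L_\theta$ be as in the context, and let $\mu^*\in\mathcal P(\mathcal Z)$. Let $\mathcal W'\subseteq\mathcal W$ be nonempty and finite, let $\mathcal J'\subseteq\mathcal J$ and $\mathcal K'\subseteq\mathcal K$ be finite, and suppose $(\mathcal J',\mathcal K')$ is column-certified for $\mathcal W'$. Then the auxiliary finite linear program has an optimizer, and, for the row residual $r^*$ of any optimizer, every $r_{\mathrm{low}}\in[-\infty,\infty)$ with $r_{\mathrm{low}}\le r^*$ satisfies $$\max\{0,\ T_{\mathrm{LP}}(\theta)+r_{\mathrm{low}}\}\ \le\ T(\theta)\ \le\ T_{\mathrm{LP}}(\theta).$$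
   Context: $\mathcal P(\mathcal S)$ is the set of probability measures on $\mathcal S$; products carry product $\sigma$-algebras; $\delta_w$ is the Dirac measure at $w$. Admissible input measures: $\Gamma_\theta=\{\gamma\in\mathcal P(\mathcal W):\mathbb E_\gamma[g_{1,j}(W;\theta)]=0\ \forall j\in\mathcal J,\ \mathbb E_\gamma[g_{2,k}(W;\theta)]\le0\ \forall k\in\mathcal K\}$, where $\mathcal J,\mathcal K$ are arbitrary index sets and the $g$'s are real-valued measurable functions on $\mathcal W$ (membership in $\Gamma_\theta$ requires their $\gamma$-integrability). Output operator: $K_\theta$ is a probability kernel from $\mathcal W$ to $\mathcal Z$, not depending on $\gamma$, whose $\mathcal X$-marginal at $(x,u)$ is $\delta_x$; $(L_\theta\gamma)(B)=\int K_\theta(B\mid w)\,d\gamma(w)$. Target: $T(\theta)=\sup_{\phi\in[0,1]^{\mathcal Z}}\inf_{\gamma\in\Gamma_\theta}(\mathbb E_{\mu^*}[\phi]-\mathbb E_{L_\theta\gamma}[\phi])$, with $\inf\varnothing=+\infty$. Restricted discrepancy: for $\mathcal J''\subseteq\mathcal J$, $\mathcal K''\subseteq\mathcal K$ (finite, or the full index sets), let $\Gamma_\theta(\mathcal W',\mathcal J'',\mathcal K'')$ be the set of measures $\gamma_p=\sum_{w\in\mathcal W'}p_w\delta_w$ with $p_w\ge0$, $\sum_{w\in\mathcal W'} p_w=1$, $\mathbb E_{\gamma_p}[g_{1,j}(W;\theta)]=0$ for all $j\in\mathcal J''$ and $\mathbb E_{\gamma_p}[g_{2,k}(W;\theta)]\le0$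 for all $k\in\mathcal K''$, and $$T(\theta;\mathcal W',\mathcal J'',\mathcal K'')=\sup_{\phi\in[0,1]^{\mathcal Z}}\inf_{\gamma_p\in\Gamma_\theta(\mathcal W',\mathcal J'',\mathcal K'')}(\mathbb E_{\mu^*}[\phi]-\mathbb E_{L_\theta\gamma_p}[\phi]).$$ Put $T_{\mathrm{LP}}(\theta)=T(\theta;\mathcal W',\mathcal J',\mathcal K')$. By linear programming duality $T_{\mathrm{LP}}(\theta)$ is the value of the auxiliary finite linear program: maximize $\mathbb E_{\mu^*}[\phi]-\zeta$ over $\phi\in[0,1]^{\mathcal Z}$, $\zeta\in\mathbb R$, $u\in\mathbb R^{\mathcal J'}$, $v\in\mathbb R_+^{\mathcal K'}$ subject to $s(w;\phi,\zeta,u,v)\ge0$ for all $w\in\mathcal W'$, where for every $w\in\mathcal W$ $$s(w;\phi,\zeta,u,v)=\zeta+\sum_{j\in\mathcal J'}u_jg_{1,j}(w;\theta)+\sum_{k\in\mathcal K'}v_kg_{2,k}(w;\theta)-q_{\phi,\theta}(w),\qquad q_{\phi,\theta}(w)=\sum_{z\in\mathcal Z}\phi(z)K_\theta(\{z\}\mid w).$$ Column certification: $(\mathcal J',\mathcal K')$ is column-certified for $\mathcal W'$ if $\Gamma_\theta(\mathcal W',\mathcal J,\mathcal K)\neq\varnothing$ and $T(\theta;\mathcal W',\mathcal J',\mathcal K')=T(\theta;\mathcal W',\mathcal J,\mathcal K)$. Row residual: for an optimizer $(\phi^*,\zeta^*,u^*,v^* )$ of the auxiliary linear program, $r^*=\inf_{w\in\mathcal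 W}s(w;\phi^*,\zeta^*,u^*,v^* )\in[-\infty,0]$. *)

theory Defs
  imports "HOL-Probability.Probability"
begin

definition admissible_measures ::
  "'w measure \<Rightarrow> ('j \<Rightarrow> 'w \<Rightarrow> real) \<Rightarrow> ('k \<Rightarrow> 'w \<Rightarrow> real) \<Rightarrow> 'j set \<Rightarrow> 'k set \<Rightarrow> 'w measure set"
where
  "admissible_measures W g1 g2 J K =
     {\<gamma> \<in> space (prob_algebra W).
        (\<forall>j\<in>J. integrable \<gamma> (g1 j) \<and> (\<integral>w. g1 j w \<partial>\<gamma>) = 0) \<and>
        (\<forall>k\<in>K. integrable \<gamma> (g2 k) \<and> (\<integral>w. g2 k w \<partial>\<gamma>) \<le> 0)}"

text \<open>Singletons of \<open>W\<close> need not be measurable, so the mixture is built on the sigma-algebra of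
  \<open>W\<close> from the Dirac measures \<open>return W w\<close>, not as a point measure.\<close>

definition dirac_mixture :: "'w measure \<Rightarrow> 'w set \<Rightarrow> ('w \<Rightarrow> real) \<Rightarrow> 'w measure" where
  "dirac_mixture W W' p =
     measure_of (space W) (sets W) (\<lambda>B. \<Sum>w\<in>W'. ennreal (p w) * emeasure (return W w) B)"

text \<open>Measurable functions are integrable with respect to a finite mixture of Dirac measures, so
  integrability need not be required here.\<close>

definition restricted_measures ::
  "'w measure \<Rightarrow> ('j \<Rightarrow> 'w \<Rightarrow> real) \<Rightarrow> ('k \<Rightarrow> 'w \<Rightarrow> real) \<Rightarrow> 'w set \<Rightarrow> 'j set \<Rightarrow> 'k set \<Rightarrow> 'w measure set"
where
  "restricted_measures W g1 g2 W' J K =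
     {dirac_mixture W W' p | p.
        (\<forall>w\<in>W'. 0 \<le> p w) \<and> (\<Sum>w\<in>W'. p w) = 1 \<and>
        (\<forall>j\<in>J. (\<integral>w. g1 j w \<partial>(dirac_mixture W W' p)) = 0) \<and>
        (\<forall>k\<in>K. (\<integral>w. g2 k w \<partial>(dirac_mixture W W' p)) \<le> 0)}"

text \<open>The output operator applied to \<open>\<gamma>\<close> is the Giry bind \<open>\<gamma> \<bind> \<kappa>\<close>. The value is extended real,
  so that the infimum over an empty \<open>\<Gamma>\<close> is \<open>\<infinity>\<close>.\<close>

definition discrepancy ::
  "'z measure \<Rightarrow> 'z measure \<Rightarrow> ('w \<Rightarrow> 'z measure) \<Rightarrow> 'w measure set \<Rightarrow> ereal"
where
  "discrepancy Z \<mu> \<kappa> \<Gamma> =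
     (SUP \<phi>\<in>space Z \<rightarrow>\<^sub>E {0..1::real}. INF \<gamma>\<in>\<Gamma>.
        ereal ((\<integral>z. \<phi> z \<partial>\<mu>) - (\<integral>z. \<phi> z \<partial>(\<gamma> \<bind> \<kappa>))))"

definition target_discrepancy ::
  "'w measure \<Rightarrow> 'z measure \<Rightarrow> ('j \<Rightarrow> 'w \<Rightarrow> real) \<Rightarrow> ('k \<Rightarrow> 'w \<Rightarrow> real) \<Rightarrow> ('w \<Rightarrow> 'z measure)
    \<Rightarrow> 'z measure \<Rightarrow> 'j set \<Rightarrow> 'k set \<Rightarrow> ereal"
where
  "target_discrepancy W Z g1 g2 \<kappa> \<mu> J K = discrepancy Z \<mu> \<kappa> (admissible_measures W g1 g2 J K)"

definition restricted_discrepancy ::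
  "'w measure \<Rightarrow> 'z measure \<Rightarrow> ('j \<Rightarrow> 'w \<Rightarrow> real) \<Rightarrow> ('k \<Rightarrow> 'w \<Rightarrow> real) \<Rightarrow> ('w \<Rightarrow> 'z measure)
    \<Rightarrow> 'z measure \<Rightarrow> 'w set \<Rightarrow> 'j set \<Rightarrow> 'k set \<Rightarrow> ereal"
where
  "restricted_discrepancy W Z g1 g2 \<kappa> \<mu> W' J K =
     discrepancy Z \<mu> \<kappa> (restricted_measures W g1 g2 W' J K)"

definition column_certified ::
  "'w measure \<Rightarrow> 'z measure \<Rightarrow> ('j \<Rightarrow> 'w \<Rightarrow> real) \<Rightarrow> ('k \<Rightarrow> 'w \<Rightarrow> real) \<Rightarrow> ('w \<Rightarrow> 'z measure)
    \<Rightarrow> 'z measure \<Rightarrow> 'j set \<Rightarrow> 'k set \<Rightarrow> 'w set \<Rightarrow> 'j set \<Rightarrow> 'k set \<Rightarrow> bool"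
where
  "column_certified W Z g1 g2 \<kappa> \<mu> J K W' J' K' \<longleftrightarrow>
     restricted_measures W g1 g2 W' J K \<noteq> {} \<and>
     restricted_discrepancy W Z g1 g2 \<kappa> \<mu> W' J' K' = restricted_discrepancy W Z g1 g2 \<kappa> \<mu> W' J K"

definition slack ::
  "'z measure \<Rightarrow> ('j \<Rightarrow> 'w \<Rightarrow> real) \<Rightarrow> ('k \<Rightarrow> 'w \<Rightarrow> real) \<Rightarrow> ('w \<Rightarrow> 'z measure) \<Rightarrow> 'j set \<Rightarrow> 'k set
    \<Rightarrow> ('z \<Rightarrow> real) \<Rightarrow> real \<Rightarrow> ('j \<Rightarrow> real) \<Rightarrow> ('k \<Rightarrow> real) \<Rightarrow> 'w \<Rightarrow> real"
where
  "slack Z g1 g2 \<kappa> J' K' \<phi> \<zeta> u v w =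
     \<zeta> + (\<Sum>j\<in>J'. u j * g1 j w) + (\<Sum>k\<in>K'. v k * g2 k w)
       - (\<Sum>z\<in>space Z. \<phi> z * measure (\<kappa> w) {z})"

definition lp_feasible ::
  "'z measure \<Rightarrow> ('j \<Rightarrow> 'w \<Rightarrow> real) \<Rightarrow> ('k \<Rightarrow> 'w \<Rightarrow> real) \<Rightarrow> ('w \<Rightarrow> 'z measure)
    \<Rightarrow> 'w set \<Rightarrow> 'j set \<Rightarrow> 'k set
    \<Rightarrow> ('z \<Rightarrow> real) \<Rightarrow> real \<Rightarrow> ('j \<Rightarrow> real) \<Rightarrow> ('k \<Rightarrow> real) \<Rightarrow> bool"
where
  "lp_feasible Z g1 g2 \<kappa> W' J' K' \<phi> \<zeta> u v \<longleftrightarrow>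
     \<phi> \<in> space Z \<rightarrow>\<^sub>E {0..1} \<and> u \<in> J' \<rightarrow>\<^sub>E UNIV \<and> v \<in> K' \<rightarrow>\<^sub>E {0..} \<and>
     (\<forall>w\<in>W'. 0 \<le> slack Z g1 g2 \<kappa> J' K' \<phi> \<zeta> u v w)"

definition lp_optimizer ::
  "'z measure \<Rightarrow> ('j \<Rightarrow> 'w \<Rightarrow> real) \<Rightarrow> ('k \<Rightarrow> 'w \<Rightarrow> real) \<Rightarrow> ('w \<Rightarrow> 'z measure) \<Rightarrow> 'z measure
    \<Rightarrow> 'w set \<Rightarrow> 'j set \<Rightarrow> 'k set
    \<Rightarrow> ('z \<Rightarrow> real) \<Rightarrow> real \<Rightarrow> ('j \<Rightarrow> real) \<Rightarrow> ('k \<Rightarrow> real) \<Rightarrow> bool"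
where
  "lp_optimizer Z g1 g2 \<kappa> \<mu> W' J' K' \<phi> \<zeta> u v \<longleftrightarrow>
     lp_feasible Z g1 g2 \<kappa> W' J' K' \<phi> \<zeta> u v \<and>
     (\<forall>\<phi>' \<zeta>' u' v'. lp_feasible Z g1 g2 \<kappa> W' J' K' \<phi>' \<zeta>' u' v' \<longrightarrow>
        (\<integral>z. \<phi>' z \<partial>\<mu>) - \<zeta>' \<le> (\<integral>z. \<phi> z \<partial>\<mu>) - \<zeta>)"

definition row_residual ::
  "'w measure \<Rightarrow> 'z measure \<Rightarrow> ('j \<Rightarrow> 'w \<Rightarrow> real) \<Rightarrow> ('k \<Rightarrow> 'w \<Rightarrow> real) \<Rightarrow> ('w \<Rightarrow> 'z measure)
    \<Rightarrow> 'j set \<Rightarrow> 'k set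
    \<Rightarrow> ('z \<Rightarrow> real) \<Rightarrow> real \<Rightarrow> ('j \<Rightarrow> real) \<Rightarrow> ('k \<Rightarrow> real) \<Rightarrow> ereal"
where
  "row_residual W Z g1 g2 \<kappa> J' K' \<phi> \<zeta> u v =
     (INF w\<in>space W. ereal (slack Z g1 g2 \<kappa> J' K' \<phi> \<zeta> u v w))"

end

theory Submission imports Defs begin

text \<open>The upper bound holds because the certified restricted measures on \<open>W'\<close> are admissible.
  For the lower bound, integrate the slack of an optimizer against an arbitrary admissible \<open>\<gamma>\<close>:
  the moment terms contribute at most \<open>0\<close>, so the test function of the optimizer alone
  guarantees the value of the linear program plus the row residual. That this value dominates the
  restricted discrepancy is linear programming duality, which, like the existence of an optimizer,
  follows from Farkas' lemma.\<close>

text \<open>The certificate is used twice. Its equality carries the upper bound from the full index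
  sets, where the mixtures are admissible, over to \<open>J'\<close> and \<open>K'\<close>. Its
  nonemptiness supplies one mixture that meets the moment constraints; averaging the slacks against
  it bounds the objective of the linear program by 1, and this boundedness is what yields an
  optimizer. Compactness does not, because \<zeta>, \<open>u\<close> and \<open>v\<close> range over
  unbounded sets; attainment is therefore derived from Farkas' lemma as well. Duality enters as the
  single inequality that the restricted discrepancy is at most the optimal value. Since the infimum
  stands inside the supremum, each test function may be answered by its own mixture, so no minimax
  exchange is involved. The 0 in the lower bound comes from the zero test function.\<close>

section \<open>Farkas' lemma and attainment in linear programs\<close>

lemma ex_real_between_finite:
  fixes L U :: "real set"
  assumes "finite L" "finite U" and "\<And>l u. l \<in> L \<Longrightarrow> u \<in> U \<Longrightarrow> l \<le> u"
  shows "\<exists>y. (\<forall>l\<in>L. l \<le> y) \<and> (\<forall>u\<in>U. y \<le> u)"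
proof (cases "L = {}")
  case True
  with assms(2) show ?thesis
    by (cases "U = {}") (auto intro: exI[of _ "Min U"])
next
  case False
  with assms show ?thesis
    by (intro exI[of _ "Max L"]) auto
qed

lemma sum_if_eq_mult:
  fixes f :: "'a \<Rightarrow> real"
  assumes "finite S" "a \<in> S"
  shows "(\<Sum>i\<in>S. (if i = a then r else 0) * f i) = r * f a"
proof -
  have "(\<Sum>i\<in>S. (if i = a then r else 0) * f i) = (\<Sum>i\<in>S. if i = a then r * f i else 0)"
    by (intro sum.cong) auto
  then show ?thesis using assms by simp
qed

text \<open>Fourier--Motzkin elimination, carried out on the multiplier vectors \<open>m\<close> instead of on the
  inequalities that they certify, so that the multipliers need not be recovered afterwards.\<close>

lemma fourier_motzkin:
  fixes a :: "'i \<Rightarrow> 'v \<Rightarrow> real" and b :: "'i \<Rightarrow> real" and M :: "('i \<Rightarrow> real) set"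
    and I :: "'i set"
  defines "A \<equiv> \<lambda>m j. \<Sum>i\<in>I. m i * a i j" and "B \<equiv> \<lambda>m. \<Sum>i\<in>I. m i * b i"
  assumes "finite X" "X \<subseteq> V" "finite M"
    and "\<forall>m\<in>M. (\<forall>i\<in>I. 0 \<le> m i) \<and> (\<forall>j\<in>V - X. A m j = 0)"
    and "\<nexists>x. \<forall>m\<in>M. (\<Sum>j\<in>X. A m j * x j) \<le> B m"
  shows "\<exists>m. (\<forall>i\<in>I. 0 \<le> m i) \<and> (\<forall>j\<in>V. A m j = 0) \<and> B m < 0"
  using assms(3-)
proof (induction X arbitrary: M rule: finite_induct)
  \<comment> \<open>With no variable left, infeasibility says that some \<open>m\<close> in
    \<open>M\<close> violates \<open>0 \<le> B m\<close>; this \<open>m\<close> is the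
    certificate.\<close>
  case empty
  then show ?case by (auto simp: not_le)
next
  case (insert n X)
  \<comment> \<open>The weights are the coefficients of \<open>n\<close> in the other row, with
    signs chosen so that \<open>n\<close> cancels. For \<open>p\<close> in \<open>P\<close> and
    \<open>q\<close> in \<open>N\<close> both weights are positive, so nonnegativity of the
    multipliers survives.\<close>
  define comb where "comb p q = (\<lambda>i. A p n * q i + (- A q n) * p i)" for p q :: "'i \<Rightarrow> real"
  define P where "P = {m\<in>M. A m n > 0}"
  define N where "N = {m\<in>M. A m n < 0}"
  define O' where "O' = {m\<in>M. A m n = 0}"
  define M' where "M' = O' \<union> (\<lambda>(p, q). comb p q) ` (P \<times> N)"
  have linear: "(\<Sum>i\<in>I. (s * q i + t * p i) * f i) = s * (\<Sum>i\<in>I. q i * f i) + t * (\<Sum>i\<in>I. p i * f i)"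
    for s t and p q f :: "'i \<Rightarrow> real"
    by (simp add: algebra_simps sum.distrib sum_distrib_left)
  have A_comb: "A (comb p q) j = A p n * A q j - A q n * A p j" for p q j
    unfolding A_def comb_def linear by simp
  have B_comb: "B (comb p q) = A p n * B q - A q n * B p" for p q
    unfolding B_def comb_def linear by simp
  have fin: "finite P" "finite N" "finite O'"
    using insert.prems(2) by (auto simp: P_def N_def O'_def)
  show ?case
  proof (rule insert.IH)
    show "X \<subseteq> V" using insert.prems by auto
    show "finite M'" using fin by (auto simp: M'_def)
    show "\<forall>m\<in>M'. (\<forall>i\<in>I. 0 \<le> m i) \<and> (\<forall>j\<in>V - X. A m j = 0)"
    proof
      fix m assume "m \<in> M'"
      then consider "m \<in> O'" | p q where "p \<in> P" "q \<in> N" "m = comb p q"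
        by (auto simp: M'_def)
      then show "(\<forall>i\<in>I. 0 \<le> m i) \<and> (\<forall>j\<in>V - X. A m j = 0)"
      proof cases
        case 1
        then show ?thesis using insert.prems(3) by (auto simp: O'_def)
      next
        case 2
        have "0 \<le> m i" if "i \<in> I" for i
          unfolding 2(3) comb_def
          using 2 that insert.prems(3) by (intro add_nonneg_nonneg mult_nonneg_nonneg) (auto simp: P_def N_def)
        moreover have "A m j = 0" if "j \<in> V - X" for j
          unfolding 2(3) A_comb
          using 2 that insert.prems(3) by (cases "j = n") (auto simp: P_def N_def)
        ultimately show ?thesis by blast
      qed
    qed
    show "\<nexists>x. \<forall>m\<in>M'. (\<Sum>j\<in>X. A m j * x j) \<le> B m"
    proof
      assume "\<exists>x. \<forall>m\<in>M'. (\<Sum>j\<in>X. A m j * x j) \<le> B m"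
      then obtain x where x: "\<And>m. m \<in> M' \<Longrightarrow> (\<Sum>j\<in>X. A m j * x j) \<le> B m" by blast
      \<comment> \<open>The bound that row \<open>m\<close> puts on variable \<open>n\<close> once
        the others are fixed to \<open>x\<close>: an upper bound for \<open>m\<close> in
        \<open>P\<close>, a lower bound for \<open>m\<close> in \<open>N\<close>. The combined rows
        say exactly that every lower bound is below every upper bound.\<close>
      define f where "f m = (B m - (\<Sum>j\<in>X. A m j * x j)) / A m n" for m
      have "f q \<le> f p" if "p \<in> P" "q \<in> N" for p q
      proof -
        have "comb p q \<in> M'" using that by (auto simp: M'_def)
        from x[OF this] have "A p n * (\<Sum>j\<in>X. A q j * x j) - A q n * (\<Sum>j\<in>X. A p j * x j)
            \<le> A p n * B q - A q n * B p"
          by (simp add: A_comb B_comb algebra_simps sum_subtractf sum_distrib_left)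
        moreover have "A p n > 0" "A q n < 0" using that by (auto simp: P_def N_def)
        ultimately show ?thesis by (simp add: f_def field_simps)
      qed
      then have "\<exists>y. (\<forall>l\<in>f ` N. l \<le> y) \<and> (\<forall>u\<in>f ` P. y \<le> u)"
        using fin by (intro ex_real_between_finite) auto
      then obtain y where y: "\<And>q. q \<in> N \<Longrightarrow> f q \<le> y" "\<And>p. p \<in> P \<Longrightarrow> y \<le> f p"
        by auto
      have eq: "(\<Sum>j\<in>insert n X. A m j * (x(n := y)) j) = A m n * y + (\<Sum>j\<in>X. A m j * x j)" for m
      proof -
        have "(\<Sum>j\<in>X. A m j * (x(n := y)) j) = (\<Sum>j\<in>X. A m j * x j)"
          using insert.hyps by (intro sum.cong) auto
        then show ?thesis using insert.hyps by (simp del: fun_upd_apply) simp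
      qed
      have "(\<Sum>j\<in>insert n X. A m j * (x(n := y)) j) \<le> B m" if "m \<in> M" for m
      proof -
        consider "m \<in> O'" | "m \<in> P" | "m \<in> N"
          using \<open>m \<in> M\<close> by (auto simp: O'_def P_def N_def) linarith
        then show ?thesis
        proof cases
          case 1
          then have "m \<in> M'" "A m n = 0" by (auto simp: M'_def O'_def)
          with x[of m] show ?thesis unfolding eq by simp
        next
          case 2
          then have "A m n > 0" by (auto simp: P_def)
          with y(2)[OF 2] show ?thesis unfolding eq by (simp add: f_def field_simps)
        next
          case 3
          then have "A m n < 0" by (auto simp: N_def)
          with y(1)[OF 3] show ?thesis unfolding eq by (simp add: f_def field_simps)
        qed
      qed
      with insert.prems(4) show False by blast
    qed
  qed
qed

text \<open>Elimination starts from the unit vectors, whose combinations are the given inequalities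
  themselves, and removes all variables of \<open>V\<close>.\<close>

lemma farkas:
  fixes a :: "'i \<Rightarrow> 'v \<Rightarrow> real" and b :: "'i \<Rightarrow> real"
  assumes V: "finite V" and I: "finite I"
    and infeasible: "\<nexists>x. \<forall>i\<in>I. (\<Sum>j\<in>V. a i j * x j) \<le> b i"
  shows "\<exists>m. (\<forall>i\<in>I. 0 \<le> m i) \<and> (\<forall>j\<in>V. (\<Sum>i\<in>I. m i * a i j) = 0) \<and> (\<Sum>i\<in>I. m i * b i) < 0"
proof -
  define e where "e i = (\<lambda>i'. if i' = i then 1 else 0 :: real)" for i :: 'i
  have e: "(\<Sum>i'\<in>I. e i i' * c i') = c i" if "i \<in> I" for i and c :: "'i \<Rightarrow> real"
    unfolding e_def using sum_if_eq_mult[OF I that, of 1 c] by simp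
  show ?thesis
    by (rule fourier_motzkin[of V V "e ` I" I a b])
      (use V I infeasible in \<open>auto simp: e, auto simp: e_def\<close>)
qed

text \<open>Sign conditions and equations are rewritten as inequalities. An equation becomes two
  opposite ones, so its multiplier \<open>z\<close> is a difference and has no fixed sign.\<close>

lemma farkas_standard_form:
  fixes a :: "'i \<Rightarrow> 'v \<Rightarrow> real" and d :: "'e \<Rightarrow> 'v \<Rightarrow> real"
  assumes fin: "finite V" "finite I" "finite E"
    and infeasible: "\<nexists>x. (\<forall>j\<in>V. 0 \<le> x j) \<and> (\<forall>i\<in>I. (\<Sum>j\<in>V. a i j * x j) \<le> b i) \<and>
      (\<forall>i\<in>E. (\<Sum>j\<in>V. d i j * x j) = c i)"
  shows "\<exists>y z. (\<forall>i\<in>I. 0 \<le> y i) \<and>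
    (\<forall>j\<in>V. 0 \<le> (\<Sum>i\<in>I. y i * a i j) + (\<Sum>i\<in>E. z i * d i j)) \<and>
    (\<Sum>i\<in>I. y i * b i) + (\<Sum>i\<in>E. z i * c i) < 0"
proof -
  \<comment> \<open>One row for each \<open>x j \<ge> 0\<close>, one for each inequality, and two
    for each equation.\<close>
  define S where "S = V <+> I <+> E <+> E"
  define A where "A = case_sum (\<lambda>j j'. if j' = j then - 1 else 0)
    (case_sum a (case_sum d (\<lambda>i j. - d i j)))"
  define B where "B = case_sum (\<lambda>_::'v. 0) (case_sum b (case_sum c (\<lambda>i. - c i)))"
  have "\<nexists>x. \<forall>i\<in>S. (\<Sum>j\<in>V. A i j * x j) \<le> B i"
  proof
    assume "\<exists>x. \<forall>i\<in>S. (\<Sum>j\<in>V. A i j * x j) \<le> B i"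
    then obtain x where x: "\<And>i. i \<in> S \<Longrightarrow> (\<Sum>j\<in>V. A i j * x j) \<le> B i" by blast
    have "0 \<le> x j" if "j \<in> V" for j
      using x[of "Inl j"] that fin sum_if_eq_mult[OF fin(1), of j "- 1" x]
      by (auto simp: S_def A_def B_def)
    moreover have "(\<Sum>j\<in>V. a i j * x j) \<le> b i" if "i \<in> I" for i
      using x[of "Inr (Inl i)"] that by (auto simp: S_def A_def B_def)
    moreover have "(\<Sum>j\<in>V. d i j * x j) = c i" if "i \<in> E" for i
      using x[of "Inr (Inr (Inl i))"] x[of "Inr (Inr (Inr i))"] that
      by (intro antisym) (auto simp: S_def A_def B_def sum_negf)
    ultimately show False using infeasible by blast
  qed
  moreover have "finite S" using fin by (auto simp: S_def)
  ultimately obtain m where m: "\<And>i. i \<in> S \<Longrightarrow> 0 \<le> m i"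
      "\<And>j. j \<in> V \<Longrightarrow> (\<Sum>i\<in>S. m i * A i j) = 0" "(\<Sum>i\<in>S. m i * B i) < 0"
    using farkas[of V S A B] fin by blast
  define y where "y i = m (Inr (Inl i))" for i
  define z where "z i = m (Inr (Inr (Inl i))) - m (Inr (Inr (Inr i)))" for i
  have sum_S: "(\<Sum>i\<in>S. f i) = (\<Sum>i\<in>V. f (Inl i)) + ((\<Sum>i\<in>I. f (Inr (Inl i))) +
      ((\<Sum>i\<in>E. f (Inr (Inr (Inl i)))) + (\<Sum>i\<in>E. f (Inr (Inr (Inr i))))))" for f :: "_ \<Rightarrow> real"
    using fin by (simp add: S_def sum.Plus)
  have "0 \<le> y i" if "i \<in> I" for i
    using m(1)[of "Inr (Inl i)"] that by (auto simp: y_def S_def)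
  moreover have "0 \<le> (\<Sum>i\<in>I. y i * a i j) + (\<Sum>i\<in>E. z i * d i j)" if "j \<in> V" for j
  proof -
    \<comment> \<open>The column identity is solved for the multiplier of
      \<open>x j \<ge> 0\<close>; its nonnegativity is the claimed inequality.\<close>
    have "(\<Sum>i\<in>V. m (Inl i) * A (Inl i) j) = - m (Inl j)"
      using sum_if_eq_mult[OF fin(1) that, of "- 1" "\<lambda>i. m (Inl i)"]
      by (simp add: A_def mult.commute eq_commute[of j])
    then have "m (Inl j) = (\<Sum>i\<in>I. y i * a i j) + (\<Sum>i\<in>E. z i * d i j)"
      using m(2)[OF that]
      by (simp add: sum_S y_def z_def A_def left_diff_distrib sum_subtractf sum_negf)
    then show ?thesis using m(1)[of "Inl j"] that by (auto simp: S_def)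
  qed
  moreover have "(\<Sum>i\<in>I. y i * b i) + (\<Sum>i\<in>E. z i * c i) < 0"
    using m(3) by (simp add: sum_S y_def z_def B_def left_diff_distrib sum_subtractf sum_negf)
  ultimately show ?thesis by blast
qed

lemma linear_program_max_attained:
  fixes a :: "'i \<Rightarrow> 'v \<Rightarrow> real" and b :: "'i \<Rightarrow> real" and c :: "'v \<Rightarrow> real"
  assumes fin: "finite V" "finite I"
    and feasible: "\<forall>i\<in>I. (\<Sum>j\<in>V. a i j * x0 j) \<le> b i"
    and bounded: "\<And>x. \<forall>i\<in>I. (\<Sum>j\<in>V. a i j * x j) \<le> b i \<Longrightarrow> (\<Sum>j\<in>V. c j * x j) \<le> \<beta>"
  shows "\<exists>x. (\<forall>i\<in>I. (\<Sum>j\<in>V. a i j * x j) \<le> b i) \<and>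
    (\<forall>x'. (\<forall>i\<in>I. (\<Sum>j\<in>V. a i j * x' j) \<le> b i) \<longrightarrow> (\<Sum>j\<in>V. c j * x' j) \<le> (\<Sum>j\<in>V. c j * x j))"
proof -
  define F where "F = {x. \<forall>i\<in>I. (\<Sum>j\<in>V. a i j * x j) \<le> b i}"
  define val where "val x = (\<Sum>j\<in>V. c j * x j)" for x
  define s where "s = (SUP x\<in>F. val x)"
  have bdd: "bdd_above (val ` F)"
    using bounded by (intro bdd_aboveI[of _ \<beta>]) (auto simp: F_def val_def)
  have x0: "x0 \<in> F" using feasible by (simp add: F_def)
  have "\<exists>x\<in>F. s \<le> val x"
  proof (rule ccontr)
    assume no: "\<not> (\<exists>x\<in>F. s \<le> val x)"
    \<comment> \<open>The index \<open>None\<close> stands for the added row, which demands an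
      objective of at least \<open>s\<close>.\<close>
    define A where "A = case_option (\<lambda>j. - c j) a"
    define B where "B = case_option (- s) b"
    have "\<nexists>x. \<forall>i\<in>insert None (Some ` I). (\<Sum>j\<in>V. A i j * x j) \<le> B i"
      using no by (auto simp: A_def B_def F_def val_def sum_negf)
    then obtain m where m: "\<forall>i\<in>insert None (Some ` I). 0 \<le> m i"
        "\<forall>j\<in>V. (\<Sum>i\<in>insert None (Some ` I). m i * A i j) = 0"
        "(\<Sum>i\<in>insert None (Some ` I). m i * B i) < 0"
      using farkas[of V "insert None (Some ` I)" A B] fin by auto
    define t where "t = m None"
    define l where "l i = m (Some i)" for i
    have nonneg: "0 \<le> t" "\<And>i. i \<in> I \<Longrightarrow> 0 \<le> l i" using m(1) by (auto simp: t_def l_def)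
    have coeff: "(\<Sum>i\<in>I. l i * a i j) = t * c j" if "j \<in> V" for j
      using m(2) that fin by (auto simp: t_def l_def A_def sum.reindex)
    have lt: "(\<Sum>i\<in>I. l i * b i) < t * s"
      using m(3) fin by (auto simp: t_def l_def B_def sum.reindex)
    have le: "t * val x \<le> (\<Sum>i\<in>I. l i * b i)" if "x \<in> F" for x
    proof -
      have "t * val x = (\<Sum>j\<in>V. (\<Sum>i\<in>I. l i * a i j) * x j)"
        unfolding val_def sum_distrib_left by (intro sum.cong) (simp_all add: coeff)
      also have "\<dots> = (\<Sum>i\<in>I. l i * (\<Sum>j\<in>V. a i j * x j))"
        unfolding sum_distrib_left sum_distrib_right mult.assoc by (rule sum.swap)
      also have "\<dots> \<le> (\<Sum>i\<in>I. l i * b i)"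
        using that nonneg by (intro sum_mono mult_left_mono) (auto simp: F_def)
      finally show ?thesis .
    qed
    \<comment> \<open>For \<open>t = 0\<close> the feasible point \<open>x0\<close> would give
      \<open>0 \<le> (\<Sum>i\<in>I. l i * b i) < 0\<close>. Positivity allows division by
      \<open>t\<close>, which gives an upper bound below the supremum.\<close>
    have "t > 0"
      using le[OF x0] lt nonneg(1) by (cases "t = 0") auto
    then have "val x \<le> (\<Sum>i\<in>I. l i * b i) / t" if "x \<in> F" for x
      using le[OF that] by (simp add: field_simps)
    then have "s \<le> (\<Sum>i\<in>I. l i * b i) / t"
      unfolding s_def using x0 by (intro cSUP_least) auto
    with lt \<open>t > 0\<close> show False by (simp add: field_simps)
  qed
  then obtain x where "x \<in> F" "s \<le> val x" by blast
  moreover have "val x' \<le> s" if "x' \<in> F" for x'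
    unfolding s_def using bdd that by (rule cSUP_upper2) simp
  ultimately show ?thesis by (intro exI[of _ x]) (force simp: F_def val_def)
qed

section \<open>The auxiliary linear program: optimizers and duality\<close>

lemma slack_cong:
  assumes "\<And>z. z \<in> space Z \<Longrightarrow> \<phi> z = \<phi>' z" "\<And>j. j \<in> J' \<Longrightarrow> u j = u' j" "\<And>k. k \<in> K' \<Longrightarrow> v k = v' k"
  shows "slack Z g1 g2 \<kappa> J' K' \<phi> \<zeta> u v w = slack Z g1 g2 \<kappa> J' K' \<phi>' \<zeta> u' v' w"
  using assms by (simp add: slack_def)

text \<open>The four groups of unknowns are packed into one vector indexed by a disjoint sum, to
  which the general attainment result applies.\<close>

lemma lp_optimizer_exists:
  fixes g1 :: "'j \<Rightarrow> 'w \<Rightarrow> real" and g2 :: "'k \<Rightarrow> 'w \<Rightarrow> real" and Z \<mu> :: "'z measure"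
  assumes fin: "finite (space Z)" "finite W'" "finite J'" "finite K'"
    and expectation: "\<And>\<phi>. (\<integral>z. \<phi> z \<partial>\<mu>) = (\<Sum>z\<in>space Z. \<phi> z * measure \<mu> {z})"
    and bounded: "\<And>\<phi> \<zeta> u v. lp_feasible Z g1 g2 \<kappa> W' J' K' \<phi> \<zeta> u v \<Longrightarrow> (\<integral>z. \<phi> z \<partial>\<mu>) - \<zeta> \<le> \<beta>"
  shows "\<exists>\<phi> \<zeta> u v. lp_optimizer Z g1 g2 \<kappa> \<mu> W' J' K' \<phi> \<zeta> u v"
proof -
  define V :: "('z + unit + 'j + 'k) set" where "V = space Z <+> {()} <+> J' <+> K'"
  \<comment> \<open>The four blocks of rows are \<open>\<phi> \<ge> 0\<close>,
    \<open>\<phi> \<le> 1\<close>, \<open>v \<ge> 0\<close> and nonnegative slack on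
    \<open>W'\<close>.\<close>
  define I where "I = space Z <+> space Z <+> K' <+> W'"
  define a :: "'z + 'z + 'k + 'w \<Rightarrow> 'z + unit + 'j + 'k \<Rightarrow> real" where
    "a = case_sum (\<lambda>z. case_sum (\<lambda>z'. if z' = z then - 1 else 0) (\<lambda>_. 0))
      (case_sum (\<lambda>z. case_sum (\<lambda>z'. if z' = z then 1 else 0) (\<lambda>_. 0))
      (case_sum (\<lambda>k. case_sum (\<lambda>_. 0) (case_sum (\<lambda>_. 0) (case_sum (\<lambda>_. 0) (\<lambda>k'. if k' = k then - 1 else 0))))
      (\<lambda>w. case_sum (\<lambda>z. measure (\<kappa> w) {z})
        (case_sum (\<lambda>_. - 1) (case_sum (\<lambda>j. - g1 j w) (\<lambda>k. - g2 k w))))))"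
  define b :: "'z + 'z + 'k + 'w \<Rightarrow> real" where "b = case_sum (\<lambda>_. 0) (case_sum (\<lambda>_. 1) (\<lambda>_. 0))"
  define c :: "'z + unit + 'j + 'k \<Rightarrow> real" where
    "c = case_sum (\<lambda>z. measure \<mu> {z}) (case_sum (\<lambda>_. - 1) (\<lambda>_. 0))"
  define x_of where "x_of \<phi> \<zeta> u v = case_sum \<phi> (case_sum (\<lambda>_::unit. \<zeta>) (case_sum u v))"
    for \<phi> :: "'z \<Rightarrow> real" and \<zeta> and u :: "'j \<Rightarrow> real" and v :: "'k \<Rightarrow> real"
  define P where "P x \<longleftrightarrow> (\<forall>i\<in>I. (\<Sum>l\<in>V. a i l * x l) \<le> b i)" for x
  define val where "val x = (\<Sum>l\<in>V. c l * x l)" for x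
  have finV: "finite V" and finI: "finite I" using fin by (auto simp: V_def I_def)
  have sum_V: "(\<Sum>l\<in>V. f l) = (\<Sum>z\<in>space Z. f (Inl z)) + (f (Inr (Inl ())) +
      ((\<Sum>j\<in>J'. f (Inr (Inr (Inl j)))) + (\<Sum>k\<in>K'. f (Inr (Inr (Inr k))))))" for f :: "_ \<Rightarrow> real"
    using fin by (simp add: V_def sum.Plus)
  have P_x_of: "P (x_of \<phi> \<zeta> u v) \<longleftrightarrow> (\<forall>z\<in>space Z. 0 \<le> \<phi> z) \<and> (\<forall>z\<in>space Z. \<phi> z \<le> 1) \<and>
      (\<forall>k\<in>K'. 0 \<le> v k) \<and> (\<forall>w\<in>W'. 0 \<le> slack Z g1 g2 \<kappa> J' K' \<phi> \<zeta> u v w)" for \<phi> \<zeta> u v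
  proof -
    have Plus_ball: "(\<forall>i\<in>A <+> B. Q i) \<longleftrightarrow> (\<forall>i\<in>A. Q (Inl i)) \<and> (\<forall>i\<in>B. Q (Inr i))"
      for A :: "'p set" and B :: "'q set" and Q by auto
    have "(\<Sum>l\<in>V. a (Inl z) l * x_of \<phi> \<zeta> u v l) = - \<phi> z" if "z \<in> space Z" for z
      using sum_if_eq_mult[OF fin(1) that, of "- 1" \<phi>] by (simp add: sum_V a_def x_of_def)
    moreover have "(\<Sum>l\<in>V. a (Inr (Inl z)) l * x_of \<phi> \<zeta> u v l) = \<phi> z" if "z \<in> space Z" for z
      using sum_if_eq_mult[OF fin(1) that, of 1 \<phi>] by (simp add: sum_V a_def x_of_def)
    moreover have "(\<Sum>l\<in>V. a (Inr (Inr (Inl k))) l * x_of \<phi> \<zeta> u v l) = - v k" if "k \<in> K'" for k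
      using sum_if_eq_mult[OF fin(4) that, of "- 1" v] by (simp add: sum_V a_def x_of_def)
    moreover have "(\<Sum>l\<in>V. a (Inr (Inr (Inr w))) l * x_of \<phi> \<zeta> u v l) =
        - slack Z g1 g2 \<kappa> J' K' \<phi> \<zeta> u v w" for w
      by (simp add: sum_V a_def x_of_def slack_def sum_negf mult.commute)
    ultimately show ?thesis
      by (simp add: P_def I_def Plus_ball b_def)
  qed
  have val_x_of: "val (x_of \<phi> \<zeta> u v) = (\<integral>z. \<phi> z \<partial>\<mu>) - \<zeta>" for \<phi> \<zeta> u v
    by (simp add: val_def sum_V c_def x_of_def expectation mult.commute)
  have P_feasible: "P (x_of \<phi> \<zeta> u v)" if "lp_feasible Z g1 g2 \<kappa> W' J' K' \<phi> \<zeta> u v" for \<phi> \<zeta> u v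
    using that by (auto simp: P_x_of lp_feasible_def PiE_iff)
  have decode: "\<exists>\<phi> \<zeta> u v. lp_feasible Z g1 g2 \<kappa> W' J' K' \<phi> \<zeta> u v \<and> val x = (\<integral>z. \<phi> z \<partial>\<mu>) - \<zeta>" if "P x" for x
  proof -
    define \<phi> where "\<phi> z = x (Inl z)" for z
    define \<zeta> where "\<zeta> = x (Inr (Inl ()))"
    define u where "u j = x (Inr (Inr (Inl j)))" for j
    define v where "v k = x (Inr (Inr (Inr k)))" for k
    have x: "x = x_of \<phi> \<zeta> u v"
      by (auto simp: x_of_def \<phi>_def \<zeta>_def u_def v_def fun_eq_iff split: sum.split)
    \<comment> \<open>\<open>lp_feasible\<close> asks for extensional functions, while a solution
      vector is arbitrary off the index sets. Restricting changes neither the slack nor the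
      objective.\<close>
    have "slack Z g1 g2 \<kappa> J' K' (restrict \<phi> (space Z)) \<zeta> (restrict u J') (restrict v K') w =
        slack Z g1 g2 \<kappa> J' K' \<phi> \<zeta> u v w" for w
      by (rule slack_cong) auto
    then have "lp_feasible Z g1 g2 \<kappa> W' J' K' (restrict \<phi> (space Z)) \<zeta> (restrict u J') (restrict v K')"
      using \<open>P x\<close> unfolding x P_x_of by (simp add: lp_feasible_def PiE_iff)
    moreover have "val x = (\<integral>z. restrict \<phi> (space Z) z \<partial>\<mu>) - \<zeta>"
      unfolding x val_x_of by (simp add: expectation)
    ultimately show ?thesis by blast
  qed
  have "\<exists>x. P x \<and> (\<forall>x'. P x' \<longrightarrow> val x' \<le> val x)"
    unfolding P_def val_def
  proof (rule linear_program_max_attained[OF finV finI])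
    \<comment> \<open>The origin is feasible: all its slacks are 0.\<close>
    show "\<forall>i\<in>I. (\<Sum>l\<in>V. a i l * x_of (\<lambda>_. 0) 0 (\<lambda>_. 0) (\<lambda>_. 0) l) \<le> b i"
      unfolding P_def[symmetric] P_x_of by (simp add: slack_def)
  next
    fix x assume "\<forall>i\<in>I. (\<Sum>l\<in>V. a i l * x l) \<le> b i"
    then have "P x" by (simp add: P_def)
    from decode[OF this] bounded show "(\<Sum>l\<in>V. c l * x l) \<le> \<beta>"
      unfolding val_def by metis
  qed
  then obtain x where x: "P x" "\<And>x'. P x' \<Longrightarrow> val x' \<le> val x" by blast
  obtain \<phi> \<zeta> u v where opt: "lp_feasible Z g1 g2 \<kappa> W' J' K' \<phi> \<zeta> u v" "val x = (\<integral>z. \<phi> z \<partial>\<mu>) - \<zeta>"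
    using decode[OF x(1)] by blast
  have "lp_optimizer Z g1 g2 \<kappa> \<mu> W' J' K' \<phi> \<zeta> u v"
    unfolding lp_optimizer_def using opt x(2)[OF P_feasible] val_x_of by auto
  then show ?thesis by blast
qed

text \<open>If \<phi> had no such mixture, Farkas multipliers for the constraints on
  \<open>p\<close> would form a point or a direction of the linear program that improves on the
  optimizer. The mixture depends on \<phi>, which need not be the optimal test function.\<close>

lemma lp_optimizer_dual:
  fixes g1 :: "'j \<Rightarrow> 'w \<Rightarrow> real" and g2 :: "'k \<Rightarrow> 'w \<Rightarrow> real" and Z \<mu> :: "'z measure"
  assumes fin: "finite W'" "finite J'" "finite K'"
    and opt: "lp_optimizer Z g1 g2 \<kappa> \<mu> W' J' K' \<phi>0 \<zeta>0 u0 v0"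
    and \<phi>: "\<phi> \<in> space Z \<rightarrow>\<^sub>E {0..1}"
  shows "\<exists>p. (\<forall>w\<in>W'. 0 \<le> p w) \<and> (\<Sum>w\<in>W'. p w) = 1 \<and> (\<forall>j\<in>J'. (\<Sum>w\<in>W'. p w * g1 j w) = 0) \<and>
    (\<forall>k\<in>K'. (\<Sum>w\<in>W'. p w * g2 k w) \<le> 0) \<and>
    (\<integral>z. \<phi> z \<partial>\<mu>) - (\<Sum>w\<in>W'. p w * (\<Sum>z\<in>space Z. \<phi> z * measure (\<kappa> w) {z})) \<le> (\<integral>z. \<phi>0 z \<partial>\<mu>) - \<zeta>0"
proof (rule ccontr)
  assume no: "\<not> ?thesis"
  define q where "q w = (\<Sum>z\<in>space Z. \<phi> z * measure (\<kappa> w) {z})" for w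
  \<comment> \<open>The last inequality of the claim reads
    \<open>t \<le> (\<Sum>w\<in>W'. p w * q w)\<close>. It is the row \<open>None\<close> of
    \<open>a\<close> and \<open>b\<close>; the row \<open>None\<close> of \<open>d\<close> and
    \<open>c\<close> normalizes the total mass to 1.\<close>
  define t where "t = (\<integral>z. \<phi> z \<partial>\<mu>) - ((\<integral>z. \<phi>0 z \<partial>\<mu>) - \<zeta>0)"
  define a where "a = case_option (\<lambda>w. - q w) g2"
  define b where "b = case_option (- t) (\<lambda>_::'k. 0)"
  define d where "d = case_option (\<lambda>_. 1) g1"
  define c where "c = case_option 1 (\<lambda>_::'j. 0 :: real)"
  let ?I = "insert None (Some ` K')" and ?E = "insert None (Some ` J')"
  have "\<nexists>p. (\<forall>w\<in>W'. 0 \<le> p w) \<and> (\<forall>i\<in>?I. (\<Sum>w\<in>W'. a i w * p w) \<le> b i) \<and>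
      (\<forall>i\<in>?E. (\<Sum>w\<in>W'. d i w * p w) = c i)"
  proof
    assume "\<exists>p. (\<forall>w\<in>W'. 0 \<le> p w) \<and> (\<forall>i\<in>?I. (\<Sum>w\<in>W'. a i w * p w) \<le> b i) \<and>
      (\<forall>i\<in>?E. (\<Sum>w\<in>W'. d i w * p w) = c i)"
    then obtain p where "\<forall>w\<in>W'. 0 \<le> p w" "\<forall>i\<in>?I. (\<Sum>w\<in>W'. a i w * p w) \<le> b i"
      "\<forall>i\<in>?E. (\<Sum>w\<in>W'. d i w * p w) = c i" by blast
    then have "(\<forall>w\<in>W'. 0 \<le> p w) \<and> (\<Sum>w\<in>W'. p w) = 1 \<and> (\<forall>j\<in>J'. (\<Sum>w\<in>W'. p w * g1 j w) = 0) \<and>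
        (\<forall>k\<in>K'. (\<Sum>w\<in>W'. p w * g2 k w) \<le> 0) \<and>
        (\<integral>z. \<phi> z \<partial>\<mu>) - (\<Sum>w\<in>W'. p w * q w) \<le> (\<integral>z. \<phi>0 z \<partial>\<mu>) - \<zeta>0"
      by (simp add: a_def b_def c_def d_def t_def sum_negf mult.commute)
    then show False using no unfolding q_def by blast
  qed
  from farkas_standard_form[OF _ _ _ this] fin obtain y z where
      yz: "\<forall>i\<in>?I. 0 \<le> y i" "\<forall>w\<in>W'. 0 \<le> (\<Sum>i\<in>?I. y i * a i w) + (\<Sum>i\<in>?E. z i * d i w)"
      "(\<Sum>i\<in>?I. y i * b i) + (\<Sum>i\<in>?E. z i * c i) < 0"
    by auto
  define s where "s = y None"
  define v where "v k = y (Some k)" for k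
  define \<zeta> where "\<zeta> = z None"
  define u where "u j = z (Some j)" for j
  have nonneg: "0 \<le> s" "\<And>k. k \<in> K' \<Longrightarrow> 0 \<le> v k" using yz(1) by (auto simp: s_def v_def)
  have slack: "s * q w \<le> \<zeta> + (\<Sum>j\<in>J'. u j * g1 j w) + (\<Sum>k\<in>K'. v k * g2 k w)" if "w \<in> W'" for w
    using yz(2) that fin by (auto simp: s_def v_def \<zeta>_def u_def a_def d_def sum.reindex)
  have lt: "\<zeta> < s * t"
    using yz(3) fin by (auto simp: s_def \<zeta>_def b_def c_def sum.reindex)
  have feasible0: "lp_feasible Z g1 g2 \<kappa> W' J' K' \<phi>0 \<zeta>0 u0 v0"
    and maximal: "\<And>\<phi>' \<zeta>' u' v'. lp_feasible Z g1 g2 \<kappa> W' J' K' \<phi>' \<zeta>' u' v' \<Longrightarrow>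
      (\<integral>z. \<phi>' z \<partial>\<mu>) - \<zeta>' \<le> (\<integral>z. \<phi>0 z \<partial>\<mu>) - \<zeta>0"
    using opt by (auto simp: lp_optimizer_def)
  show False
  proof (cases "s = 0")
    \<comment> \<open>Here \<open>\<zeta> < 0\<close> and the multipliers form an improving
      direction: added to the optimizer, with \<open>\<phi>0\<close> kept, they preserve feasibility
      and raise the objective by \<open>- \<zeta>\<close>.\<close>
    case True
    define u1 where "u1 = restrict (\<lambda>j. u0 j + u j) J'"
    define v1 where "v1 = restrict (\<lambda>k. v0 k + v k) K'"
    have "0 \<le> slack Z g1 g2 \<kappa> J' K' \<phi>0 (\<zeta>0 + \<zeta>) u1 v1 w" if "w \<in> W'" for w
    proof -
      have "0 \<le> slack Z g1 g2 \<kappa> J' K' \<phi>0 \<zeta>0 u0 v0 w"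
        using feasible0 that by (simp add: lp_feasible_def)
      then show ?thesis
        using slack[OF that] True
        by (simp add: slack_def u1_def v1_def distrib_right sum.distrib)
    qed
    then have "lp_feasible Z g1 g2 \<kappa> W' J' K' \<phi>0 (\<zeta>0 + \<zeta>) u1 v1"
      using feasible0 nonneg by (auto simp: lp_feasible_def u1_def v1_def PiE_iff)
    from maximal[OF this] lt True show False by simp
  next
    case False
    \<comment> \<open>Dividing by \<open>s\<close> gives a feasible point with test function \<phi>.
      As \<open>\<zeta> / s < t\<close>, its objective exceeds the optimum.\<close>
    with nonneg have s: "s > 0" by simp
    define u1 where "u1 = restrict (\<lambda>j. u j / s) J'"
    define v1 where "v1 = restrict (\<lambda>k. v k / s) K'"
    have "0 \<le> slack Z g1 g2 \<kappa> J' K' \<phi> (\<zeta> / s) u1 v1 w" if "w \<in> W'" for w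
    proof -
      have "slack Z g1 g2 \<kappa> J' K' \<phi> (\<zeta> / s) u1 v1 w =
          (\<zeta> + (\<Sum>j\<in>J'. u j * g1 j w) + (\<Sum>k\<in>K'. v k * g2 k w)) / s - q w"
        by (simp add: slack_def u1_def v1_def q_def add_divide_distrib sum_divide_distrib)
      moreover have "q w \<le> (\<zeta> + (\<Sum>j\<in>J'. u j * g1 j w) + (\<Sum>k\<in>K'. v k * g2 k w)) / s"
        using slack[OF that] s by (simp add: pos_le_divide_eq mult.commute)
      ultimately show ?thesis by simp
    qed
    then have "lp_feasible Z g1 g2 \<kappa> W' J' K' \<phi> (\<zeta> / s) u1 v1"
      using \<phi> nonneg by (auto simp: lp_feasible_def u1_def v1_def PiE_iff)
    from maximal[OF this] have "t \<le> \<zeta> / s" by (simp add: t_def)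
    with lt s show False by (simp add: field_simps)
  qed
qed

section \<open>Expectations on the finite outcome space and under Dirac mixtures\<close>

lemma integral_finite_discrete:
  fixes \<phi> :: "'z \<Rightarrow> real"
  assumes Z: "finite (space Z)" "sets Z = Pow (space Z)" and \<nu>: "\<nu> \<in> space (prob_algebra Z)"
  shows "(\<integral>z. \<phi> z \<partial>\<nu>) = (\<Sum>z\<in>space Z. \<phi> z * measure \<nu> {z})"
proof -
  interpret prob_space \<nu> using \<nu> by (simp add: space_prob_algebra)
  have sets: "sets \<nu> = Pow (space Z)" and space: "space \<nu> = space Z"
    using \<nu> Z sets_eq_imp_space_eq[of \<nu> Z] by (auto simp: space_prob_algebra)
  have "(\<integral>z. \<phi> z \<partial>\<nu>) = (\<integral>z. (\<Sum>y\<in>space Z. \<phi> y * indicator {y} z) \<partial>\<nu>)"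
  proof (rule Bochner_Integration.integral_cong)
    fix z assume "z \<in> space \<nu>"
    then have "z \<in> space Z" by (simp add: space)
    then show "\<phi> z = (\<Sum>y\<in>space Z. \<phi> y * indicator {y} z)"
      using Z(1) by (simp add: indicator_def if_distrib cong: if_cong)
  qed simp
  also have "\<dots> = (\<Sum>y\<in>space Z. \<phi> y * measure \<nu> {y})"
    using Z(1) sets by (subst Bochner_Integration.integral_sum) (auto simp: less_top[symmetric])
  finally show ?thesis .
qed

lemma bind_in_space_prob_algebra:
  assumes "\<gamma> \<in> space (prob_algebra W)" "\<kappa> \<in> W \<rightarrow>\<^sub>M prob_algebra Z"
  shows "\<gamma> \<bind> \<kappa> \<in> space (prob_algebra Z)"
  using measurable_space[OF measurable_bind_prob_space[OF measurable_ident_sets[OF refl] assms(2)] assms(1)] .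

text \<open>Finiteness of the outcome space reduces the integral to singleton masses. Each mass of
  the bind is the mean of kernel masses in [0,1], and linearity does the rest.\<close>

lemma integral_bind_finite_discrete:
  fixes \<phi> :: "'z \<Rightarrow> real"
  assumes Z: "finite (space Z)" "sets Z = Pow (space Z)"
    and \<gamma>: "\<gamma> \<in> space (prob_algebra W)" and \<kappa>: "\<kappa> \<in> W \<rightarrow>\<^sub>M prob_algebra Z"
  shows "integrable \<gamma> (\<lambda>w. \<Sum>z\<in>space Z. \<phi> z * measure (\<kappa> w) {z})"
    and "(\<integral>z. \<phi> z \<partial>(\<gamma> \<bind> \<kappa>)) = (\<integral>w. (\<Sum>z\<in>space Z. \<phi> z * measure (\<kappa> w) {z}) \<partial>\<gamma>)"
proof -
  interpret prob_space \<gamma> using \<gamma> by (simp add: space_prob_algebra)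
  have "sets \<gamma> = sets W" using \<gamma> by (simp add: space_prob_algebra)
  then have \<kappa>': "\<kappa> \<in> \<gamma> \<rightarrow>\<^sub>M prob_algebra Z"
    using \<kappa> measurable_cong_sets[of \<gamma> W "prob_algebra Z"] by simp
  then have \<kappa>'': "\<kappa> \<in> \<gamma> \<rightarrow>\<^sub>M subprob_algebra Z"
    by (rule measurable_prob_algebraD)
  have int: "integrable \<gamma> (\<lambda>w. measure (\<kappa> w) {z})" if "z \<in> space Z" for z
  proof (rule integrable_const_bound[where B = 1])
    show "AE w in \<gamma>. norm (measure (\<kappa> w) {z}) \<le> 1"
      using measurable_space[OF \<kappa>'] by (auto simp: space_prob_algebra intro: prob_space.prob_le_1)
    show "(\<lambda>w. measure (\<kappa> w) {z}) \<in> borel_measurable \<gamma>"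
      using that Z by (intro measurable_compose[OF \<kappa>'' measurable_measure_subprob_algebra]) auto
  qed
  then show "integrable \<gamma> (\<lambda>w. \<Sum>z\<in>space Z. \<phi> z * measure (\<kappa> w) {z})" by auto
  have "(\<integral>z. \<phi> z \<partial>(\<gamma> \<bind> \<kappa>)) = (\<Sum>z\<in>space Z. \<phi> z * measure (\<gamma> \<bind> \<kappa>) {z})"
    using bind_in_space_prob_algebra[OF \<gamma> \<kappa>] by (intro integral_finite_discrete Z)
  also have "\<dots> = (\<Sum>z\<in>space Z. \<phi> z * (\<integral>w. measure (\<kappa> w) {z} \<partial>\<gamma>))"
    using Z by (intro sum.cong) (auto simp: measure_bind[OF \<kappa>''])
  also have "\<dots> = (\<integral>w. (\<Sum>z\<in>space Z. \<phi> z * measure (\<kappa> w) {z}) \<partial>\<gamma>)"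
    using int by (subst Bochner_Integration.integral_sum) auto
  finally show "(\<integral>z. \<phi> z \<partial>(\<gamma> \<bind> \<kappa>)) = (\<integral>w. (\<Sum>z\<in>space Z. \<phi> z * measure (\<kappa> w) {z}) \<partial>\<gamma>)" .
qed

text \<open>This shows that the set function behind \<open>dirac_mixture\<close> is a measure and
  gives access to the integration rules. In \<open>point_measure W' p\<close> all subsets of
  \<open>W'\<close> are measurable, so the identity into \<open>W\<close> is measurable whatever the
  sigma-algebra of \<open>W\<close>.\<close>

lemma dirac_mixture_eq_distr:
  assumes W': "W' \<subseteq> space W" "finite W'" and p: "\<And>w. w \<in> W' \<Longrightarrow> 0 \<le> p w"
  shows "dirac_mixture W W' p = distr (point_measure W' p) W (\<lambda>w. w)"
proof -
  let ?D = "distr (point_measure W' p) W (\<lambda>w. w)"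
  have meas: "(\<lambda>w. w) \<in> point_measure W' p \<rightarrow>\<^sub>M W"
    using W' by (auto simp: measurable_def space_point_measure sets_point_measure)
  have "(\<Sum>w\<in>W'. ennreal (p w) * emeasure (return W w) B) = emeasure ?D B" if "B \<in> sets W" for B
  proof -
    have "emeasure ?D B = emeasure (point_measure W' p) (W' \<inter> B)"
      using that meas by (simp add: emeasure_distr space_point_measure Int_commute)
    also have "\<dots> = (\<Sum>w\<in>W' \<inter> B. ennreal (p w))"
      using W' by (subst emeasure_point_measure_finite) auto
    also have "\<dots> = (\<Sum>w\<in>W'. ennreal (p w) * emeasure (return W w) B)"
      using W' that by (intro sum.mono_neutral_cong_left) (auto simp: indicator_def)
    finally show ?thesis by simp
  qed
  then have "dirac_mixture W W' p = measure_of (space W) (sets W) (emeasure ?D)"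
    unfolding dirac_mixture_def
    by (intro measure_of_eq) (auto simp: sets.space_closed sets.sigma_sets_eq)
  also have "\<dots> = ?D"
    using measure_of_of_measure[of ?D] by simp
  finally show ?thesis .
qed

lemma dirac_mixture_in_prob_algebra:
  assumes "W' \<subseteq> space W" "finite W'" "\<And>w. w \<in> W' \<Longrightarrow> 0 \<le> p w" "(\<Sum>w\<in>W'. p w) = 1"
  shows "dirac_mixture W W' p \<in> space (prob_algebra W)"
proof -
  have meas: "(\<lambda>w. w) \<in> point_measure W' p \<rightarrow>\<^sub>M W"
    using assms by (auto simp: measurable_def space_point_measure sets_point_measure)
  have "prob_space (point_measure W' p)"
    using assms by (intro prob_spaceI) (simp add: space_point_measure emeasure_point_measure_finite sum_ennreal)
  then show ?thesis
    using assms meas by (simp add: dirac_mixture_eq_distr space_prob_algebra prob_space.prob_space_distr)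
qed

lemma integral_dirac_mixture:
  fixes f :: "'w \<Rightarrow> real"
  assumes "W' \<subseteq> space W" "finite W'" "\<And>w. w \<in> W' \<Longrightarrow> 0 \<le> p w" and f: "f \<in> borel_measurable W"
  shows "integrable (dirac_mixture W W' p) f"
    and "(\<integral>w. f w \<partial>(dirac_mixture W W' p)) = (\<Sum>w\<in>W'. p w * f w)"
proof -
  have meas: "(\<lambda>w. w) \<in> point_measure W' p \<rightarrow>\<^sub>M W"
    using assms by (auto simp: measurable_def space_point_measure sets_point_measure)
  show "integrable (dirac_mixture W W' p) f"
    using assms meas
    by (simp add: dirac_mixture_eq_distr integrable_distr_eq integrable_point_measure_finite)
  show "(\<integral>w. f w \<partial>(dirac_mixture W W' p)) = (\<Sum>w\<in>W'. p w * f w)"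
    using assms meas
    by (simp add: dirac_mixture_eq_distr integral_distr lebesgue_integral_point_measure_finite)
qed

section \<open>Bounds on the discrepancies and on the linear program\<close>

lemma restricted_measures_subset_admissible:
  assumes "W' \<subseteq> space W" "finite W'"
    and "\<And>j. j \<in> J \<Longrightarrow> g1 j \<in> borel_measurable W" "\<And>k. k \<in> K \<Longrightarrow> g2 k \<in> borel_measurable W"
  shows "restricted_measures W g1 g2 W' J K \<subseteq> admissible_measures W g1 g2 J K"
  using assms
  by (auto simp: restricted_measures_def admissible_measures_def
      intro!: dirac_mixture_in_prob_algebra integral_dirac_mixture(1))

lemma discrepancy_antimono:
  assumes "\<Gamma> \<subseteq> \<Gamma>'"
  shows "discrepancy Z \<mu> \<kappa> \<Gamma>' \<le> discrepancy Z \<mu> \<kappa> \<Gamma>"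
  unfolding discrepancy_def
  by (intro SUP_subset_mono INF_superset_mono assms order.refl)

text \<open>The zero test function makes every difference 0; over an empty \<open>\<Gamma>\<close>
  the infimum is \<infinity>, which is nonnegative too.\<close>

lemma discrepancy_nonneg:
  assumes Z: "finite (space Z)" "sets Z = Pow (space Z)" and \<mu>: "\<mu> \<in> space (prob_algebra Z)"
    and \<Gamma>: "\<And>\<gamma>. \<gamma> \<in> \<Gamma> \<Longrightarrow> \<gamma> \<bind> \<kappa> \<in> space (prob_algebra Z)"
  shows "0 \<le> discrepancy Z \<mu> \<kappa> \<Gamma>"
proof -
  let ?\<phi> = "\<lambda>z\<in>space Z. 0 :: real"
  have zero: "(\<integral>z. ?\<phi> z \<partial>\<nu>) = 0" if "\<nu> \<in> space (prob_algebra Z)" for \<nu>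
    using integral_finite_discrete[OF Z that, of ?\<phi>] by simp
  have "0 \<le> (INF \<gamma>\<in>\<Gamma>. ereal ((\<integral>z. ?\<phi> z \<partial>\<mu>) - (\<integral>z. ?\<phi> z \<partial>(\<gamma> \<bind> \<kappa>))))"
    using zero[OF \<mu>] zero[OF \<Gamma>] by (intro INF_greatest) simp
  also have "\<dots> \<le> discrepancy Z \<mu> \<kappa> \<Gamma>"
    unfolding discrepancy_def by (rule SUP_upper) auto
  finally show ?thesis .
qed

lemma restricted_discrepancy_le_lp_value:
  assumes Z: "finite (space Z)" "sets Z = Pow (space Z)" and \<kappa>: "\<kappa> \<in> W \<rightarrow>\<^sub>M prob_algebra Z"
    and W': "W' \<subseteq> space W" "finite W'" and fin: "finite J'" "finite K'"
    and g1: "\<And>j. j \<in> J' \<Longrightarrow> g1 j \<in> borel_measurable W"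
    and g2: "\<And>k. k \<in> K' \<Longrightarrow> g2 k \<in> borel_measurable W"
    and opt: "lp_optimizer Z g1 g2 \<kappa> \<mu> W' J' K' \<phi>0 \<zeta>0 u0 v0"
  shows "restricted_discrepancy W Z g1 g2 \<kappa> \<mu> W' J' K' \<le> ereal ((\<integral>z. \<phi>0 z \<partial>\<mu>) - \<zeta>0)"
  unfolding restricted_discrepancy_def discrepancy_def
proof (rule SUP_least)
  fix \<phi> :: "_ \<Rightarrow> real" assume \<phi>: "\<phi> \<in> space Z \<rightarrow>\<^sub>E {0..1}"
  obtain p where p: "\<forall>w\<in>W'. 0 \<le> p w" "(\<Sum>w\<in>W'. p w) = 1" "\<forall>j\<in>J'. (\<Sum>w\<in>W'. p w * g1 j w) = 0"
      "\<forall>k\<in>K'. (\<Sum>w\<in>W'. p w * g2 k w) \<le> 0"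
      "(\<integral>z. \<phi> z \<partial>\<mu>) - (\<Sum>w\<in>W'. p w * (\<Sum>z\<in>space Z. \<phi> z * measure (\<kappa> w) {z})) \<le> (\<integral>z. \<phi>0 z \<partial>\<mu>) - \<zeta>0"
    using lp_optimizer_dual[OF W'(2) fin opt \<phi>] by blast
  have prob: "dirac_mixture W W' p \<in> space (prob_algebra W)"
    using W' p by (intro dirac_mixture_in_prob_algebra) auto
  have int: "(\<integral>w. f w \<partial>(dirac_mixture W W' p)) = (\<Sum>w\<in>W'. p w * f w)"
    if "f \<in> borel_measurable W" for f :: "_ \<Rightarrow> real"
    using W' p that by (intro integral_dirac_mixture) auto
  have mem: "dirac_mixture W W' p \<in> restricted_measures W g1 g2 W' J' K'"
    using p g1 g2 unfolding restricted_measures_def by (auto simp: int intro!: exI[of _ p])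
  have "(\<lambda>w. \<Sum>z\<in>space Z. \<phi> z * measure (\<kappa> w) {z}) \<in> borel_measurable W"
    using Z measurable_compose[OF measurable_prob_algebraD[OF \<kappa>] measurable_measure_subprob_algebra]
    by (intro borel_measurable_sum borel_measurable_times) auto
  then have "(\<integral>z. \<phi> z \<partial>(dirac_mixture W W' p \<bind> \<kappa>)) =
      (\<Sum>w\<in>W'. p w * (\<Sum>z\<in>space Z. \<phi> z * measure (\<kappa> w) {z}))"
    using integral_bind_finite_discrete(2)[OF Z prob \<kappa>] by (simp add: int)
  with p(5) show "(INF \<gamma>\<in>restricted_measures W g1 g2 W' J' K'.
      ereal ((\<integral>z. \<phi> z \<partial>\<mu>) - (\<integral>z. \<phi> z \<partial>(\<gamma> \<bind> \<kappa>)))) \<le> ereal ((\<integral>z. \<phi>0 z \<partial>\<mu>) - \<zeta>0)"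
    by (intro INF_lower2[OF mem]) simp
qed

text \<open>Weak duality against all admissible measures instead of mixtures on \<open>W'\<close>;
  the price is the global lower bound \<open>r\<close> of the slack, which may be negative.\<close>

lemma lp_value_le_target_discrepancy:
  assumes Z: "finite (space Z)" "sets Z = Pow (space Z)" and \<kappa>: "\<kappa> \<in> W \<rightarrow>\<^sub>M prob_algebra Z"
    and "J' \<subseteq> J" "K' \<subseteq> K" and fin: "finite J'" "finite K'"
    and \<phi>: "\<phi> \<in> space Z \<rightarrow>\<^sub>E {0..1}" and v: "\<And>k. k \<in> K' \<Longrightarrow> 0 \<le> v k"
    and slack: "\<And>w. w \<in> space W \<Longrightarrow> r \<le> slack Z g1 g2 \<kappa> J' K' \<phi> \<zeta> u v w"
  shows "ereal ((\<integral>z. \<phi> z \<partial>\<mu>) - \<zeta> + r) \<le> target_discrepancy W Z g1 g2 \<kappa> \<mu> J K"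
proof -
  have "ereal ((\<integral>z. \<phi> z \<partial>\<mu>) - \<zeta> + r) \<le> ereal ((\<integral>z. \<phi> z \<partial>\<mu>) - (\<integral>z. \<phi> z \<partial>(\<gamma> \<bind> \<kappa>)))"
    if "\<gamma> \<in> admissible_measures W g1 g2 J K" for \<gamma>
  proof -
    have \<gamma>: "\<gamma> \<in> space (prob_algebra W)"
      and g1: "\<And>j. j \<in> J' \<Longrightarrow> integrable \<gamma> (g1 j)" "\<And>j. j \<in> J' \<Longrightarrow> (\<integral>w. g1 j w \<partial>\<gamma>) = 0"
      and g2: "\<And>k. k \<in> K' \<Longrightarrow> integrable \<gamma> (g2 k)" "\<And>k. k \<in> K' \<Longrightarrow> (\<integral>w. g2 k w \<partial>\<gamma>) \<le> 0"
      using that assms(4,5) by (auto simp: admissible_measures_def)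
    interpret prob_space \<gamma> using \<gamma> by (simp add: space_prob_algebra)
    have space: "space \<gamma> = space W"
      using \<gamma> by (intro sets_eq_imp_space_eq) (simp add: space_prob_algebra)
    note q = integral_bind_finite_discrete[OF Z \<gamma> \<kappa>, of \<phi>]
    let ?s = "slack Z g1 g2 \<kappa> J' K' \<phi> \<zeta> u v"
    have int: "integrable \<gamma> ?s"
      unfolding slack_def using g1 g2 q(1) by auto
    have "(\<integral>w. ?s w \<partial>\<gamma>) = \<zeta> + (\<Sum>k\<in>K'. v k * (\<integral>w. g2 k w \<partial>\<gamma>)) - (\<integral>z. \<phi> z \<partial>(\<gamma> \<bind> \<kappa>))"
      unfolding slack_def q(2) using g1 g2 q(1) by (simp add: prob_space)
    also have "\<dots> \<le> \<zeta> - (\<integral>z. \<phi> z \<partial>(\<gamma> \<bind> \<kappa>))"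
      using v g2(2) by (simp add: sum_nonpos mult_nonneg_nonpos)
    finally have "(\<integral>w. ?s w \<partial>\<gamma>) \<le> \<zeta> - (\<integral>z. \<phi> z \<partial>(\<gamma> \<bind> \<kappa>))" .
    \<comment> \<open>The pointwise bound passes to the mean because \<gamma> has total mass
      1.\<close>
    moreover have "r \<le> (\<integral>w. ?s w \<partial>\<gamma>)"
      using slack by (intro integral_ge_const int AE_I2) (simp add: space)
    ultimately show ?thesis by simp
  qed
  then have "ereal ((\<integral>z. \<phi> z \<partial>\<mu>) - \<zeta> + r) \<le>
      (INF \<gamma>\<in>admissible_measures W g1 g2 J K. ereal ((\<integral>z. \<phi> z \<partial>\<mu>) - (\<integral>z. \<phi> z \<partial>(\<gamma> \<bind> \<kappa>))))"
    by (rule INF_greatest)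
  also have "\<dots> \<le> target_discrepancy W Z g1 g2 \<kappa> \<mu> J K"
    unfolding target_discrepancy_def discrepancy_def using \<phi> by (rule SUP_upper)
  finally show ?thesis .
qed

text \<open>Averaging the slacks against \<open>p\<close> removes the moment terms in the favourable
  direction and leaves \<open>\<zeta> \<ge> 0\<close>. The objective is then at most the mean of a
  test function bounded by 1.\<close>

lemma lp_value_le_one:
  assumes Z: "finite (space Z)" "sets Z = Pow (space Z)" and \<mu>: "\<mu> \<in> space (prob_algebra Z)"
    and fin: "finite W'" "finite J'" "finite K'"
    and p: "\<And>w. w \<in> W' \<Longrightarrow> 0 \<le> p w" "(\<Sum>w\<in>W'. p w) = 1"
    and g1: "\<And>j. j \<in> J' \<Longrightarrow> (\<Sum>w\<in>W'. p w * g1 j w) = 0"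
    and g2: "\<And>k. k \<in> K' \<Longrightarrow> (\<Sum>w\<in>W'. p w * g2 k w) \<le> 0"
    and feasible: "lp_feasible Z g1 g2 \<kappa> W' J' K' \<phi> \<zeta> u v"
  shows "(\<integral>z. \<phi> z \<partial>\<mu>) - \<zeta> \<le> 1"
proof -
  interpret prob_space \<mu> using \<mu> by (simp add: space_prob_algebra)
  have sets: "sets \<mu> = Pow (space Z)" and space: "space \<mu> = space Z"
    using \<mu> Z sets_eq_imp_space_eq[of \<mu> Z] by (auto simp: space_prob_algebra)
  let ?q = "\<lambda>w. \<Sum>z\<in>space Z. \<phi> z * measure (\<kappa> w) {z}"
  have \<phi>: "\<And>z. z \<in> space Z \<Longrightarrow> 0 \<le> \<phi> z \<and> \<phi> z \<le> 1" and v: "\<And>k. k \<in> K' \<Longrightarrow> 0 \<le> v k"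
    using feasible by (auto simp: lp_feasible_def PiE_iff)
  have "0 \<le> (\<Sum>w\<in>W'. p w * slack Z g1 g2 \<kappa> J' K' \<phi> \<zeta> u v w)"
    using feasible p by (intro sum_nonneg mult_nonneg_nonneg) (auto simp: lp_feasible_def)
  also have "\<dots> = \<zeta> * (\<Sum>w\<in>W'. p w) + (\<Sum>w\<in>W'. \<Sum>j\<in>J'. u j * (p w * g1 j w)) +
      (\<Sum>w\<in>W'. \<Sum>k\<in>K'. v k * (p w * g2 k w)) - (\<Sum>w\<in>W'. p w * ?q w)"
    by (simp add: slack_def distrib_left right_diff_distrib sum.distrib sum_subtractf
        sum_distrib_left mult_ac)
  also have "\<dots> = \<zeta> + (\<Sum>j\<in>J'. u j * (\<Sum>w\<in>W'. p w * g1 j w)) +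
      (\<Sum>k\<in>K'. v k * (\<Sum>w\<in>W'. p w * g2 k w)) - (\<Sum>w\<in>W'. p w * ?q w)"
    by (simp add: p(2) sum_distrib_left sum.swap[of _ _ W'])
  also have "\<dots> \<le> \<zeta>"
  proof -
    have "(\<Sum>j\<in>J'. u j * (\<Sum>w\<in>W'. p w * g1 j w)) = 0" using g1 by simp
    moreover have "(\<Sum>k\<in>K'. v k * (\<Sum>w\<in>W'. p w * g2 k w)) \<le> 0"
      by (intro sum_nonpos mult_nonneg_nonpos v g2)
    moreover have "0 \<le> (\<Sum>w\<in>W'. p w * ?q w)"
      using p(1) \<phi> by (intro sum_nonneg mult_nonneg_nonneg) auto
    ultimately show ?thesis by linarith
  qed
  finally have "0 \<le> \<zeta>" .
  moreover have "(\<integral>z. \<phi> z \<partial>\<mu>) \<le> 1"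
  proof (rule integral_le_const)
    have "\<bar>\<phi> z\<bar> \<le> 1" if "z \<in> space Z" for z using \<phi>[OF that] by simp
    then show "integrable \<mu> \<phi>"
      using sets by (intro integrable_const_bound[where B = 1] AE_I2) (auto simp: space measurable_def)
    show "AE z in \<mu>. \<phi> z \<le> 1" using \<phi> by (intro AE_I2) (simp add: space)
  qed
  ultimately show ?thesis by simp
qed

section \<open>The certified two-sided bound\<close>

theorem theorem3:
  fixes MY :: "'y measure" and MX :: "'x measure" and MU :: "'u measure"
    and \<Theta> :: "'t set" and \<theta> :: 't
    and J :: "'j set" and K :: "'k set"
    and g1 :: "'t \<Rightarrow> 'j \<Rightarrow> 'x \<times> 'u \<Rightarrow> real" and g2 :: "'t \<Rightarrow> 'k \<Rightarrow> 'x \<times> 'u \<Rightarrow> real"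
    and \<kappa> :: "'t \<Rightarrow> 'x \<times> 'u \<Rightarrow> ('y \<times> 'x) measure"
    and \<mu> :: "('y \<times> 'x) measure"
    and W' :: "('x \<times> 'u) set" and J' :: "'j set" and K' :: "'k set"
  assumes Z_finite: "finite (space (MY \<Otimes>\<^sub>M MX))"
    and Z_discrete: "sets (MY \<Otimes>\<^sub>M MX) = Pow (space (MY \<Otimes>\<^sub>M MX))"
    and theta: "\<theta> \<in> \<Theta>"
    and g1_measurable: "\<And>t j. t \<in> \<Theta> \<Longrightarrow> j \<in> J \<Longrightarrow> g1 t j \<in> borel_measurable (MX \<Otimes>\<^sub>M MU)"
    and g2_measurable: "\<And>t k. t \<in> \<Theta> \<Longrightarrow> k \<in> K \<Longrightarrow> g2 t k \<in> borel_measurable (MX \<Otimes>\<^sub>M MU)"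
    and kernel: "\<And>t. t \<in> \<Theta> \<Longrightarrow> \<kappa> t \<in> MX \<Otimes>\<^sub>M MU \<rightarrow>\<^sub>M prob_algebra (MY \<Otimes>\<^sub>M MX)"
    and kernel_marginal: "\<And>t x u. t \<in> \<Theta> \<Longrightarrow> x \<in> space MX \<Longrightarrow> u \<in> space MU \<Longrightarrow>
          distr (\<kappa> t (x, u)) MX snd = return MX x"
    and mu: "\<mu> \<in> space (prob_algebra (MY \<Otimes>\<^sub>M MX))"
    and W': "W' \<subseteq> space (MX \<Otimes>\<^sub>M MU)" "W' \<noteq> {}" "finite W'"
    and J': "J' \<subseteq> J" "finite J'"
    and K': "K' \<subseteq> K" "finite K'"
    and certified: "column_certified (MX \<Otimes>\<^sub>M MU) (MY \<Otimes>\<^sub>M MX) (g1 \<theta>) (g2 \<theta>) (\<kappa> \<theta>) \<mu> J K W' J' K'"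
  shows "(\<exists>\<phi> \<zeta> u v. lp_optimizer (MY \<Otimes>\<^sub>M MX) (g1 \<theta>) (g2 \<theta>) (\<kappa> \<theta>) \<mu> W' J' K' \<phi> \<zeta> u v) \<and>
    (\<forall>\<phi> \<zeta> u v r_low.
       lp_optimizer (MY \<Otimes>\<^sub>M MX) (g1 \<theta>) (g2 \<theta>) (\<kappa> \<theta>) \<mu> W' J' K' \<phi> \<zeta> u v \<longrightarrow>
       r_low < \<infinity> \<longrightarrow>
       r_low \<le> row_residual (MX \<Otimes>\<^sub>M MU) (MY \<Otimes>\<^sub>M MX) (g1 \<theta>) (g2 \<theta>) (\<kappa> \<theta>) J' K' \<phi> \<zeta> u v \<longrightarrow>
       max 0 (restricted_discrepancy (MX \<Otimes>\<^sub>M MU) (MY \<Otimes>\<^sub>M MX) (g1 \<theta>) (g2 \<theta>) (\<kappa> \<theta>) \<mu> W' J' K' + r_low)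
         \<le> target_discrepancy (MX \<Otimes>\<^sub>M MU) (MY \<Otimes>\<^sub>M MX) (g1 \<theta>) (g2 \<theta>) (\<kappa> \<theta>) \<mu> J K \<and>
       target_discrepancy (MX \<Otimes>\<^sub>M MU) (MY \<Otimes>\<^sub>M MX) (g1 \<theta>) (g2 \<theta>) (\<kappa> \<theta>) \<mu> J K
         \<le> restricted_discrepancy (MX \<Otimes>\<^sub>M MU) (MY \<Otimes>\<^sub>M MX) (g1 \<theta>) (g2 \<theta>) (\<kappa> \<theta>) \<mu> W' J' K')"
proof -
  let ?W = "MX \<Otimes>\<^sub>M MU" and ?Z = "MY \<Otimes>\<^sub>M MX"
  let ?LP = "restricted_discrepancy ?W ?Z (g1 \<theta>) (g2 \<theta>) (\<kappa> \<theta>) \<mu> W' J' K'"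
  let ?T = "target_discrepancy ?W ?Z (g1 \<theta>) (g2 \<theta>) (\<kappa> \<theta>) \<mu> J K"
  let ?opt = "lp_optimizer ?Z (g1 \<theta>) (g2 \<theta>) (\<kappa> \<theta>) \<mu> W' J' K'"
  note Z = Z_finite Z_discrete
  note \<kappa> = kernel[OF theta] and g1 = g1_measurable[OF theta] and g2 = g2_measurable[OF theta]
  \<comment> \<open>This mixture satisfies the constraints of all of \<open>J\<close> and
    \<open>K\<close>, hence those of \<open>J'\<close> and \<open>K'\<close>, and so bounds the
    linear program.\<close>
  from certified obtain p where p: "\<And>w. w \<in> W' \<Longrightarrow> 0 \<le> p w" "(\<Sum>w\<in>W'. p w) = 1"
      "\<And>j. j \<in> J \<Longrightarrow> (\<integral>w. g1 \<theta> j w \<partial>(dirac_mixture ?W W' p)) = 0"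
      "\<And>k. k \<in> K \<Longrightarrow> (\<integral>w. g2 \<theta> k w \<partial>(dirac_mixture ?W W' p)) \<le> 0"
    unfolding column_certified_def restricted_measures_def by auto
  have integral_p: "(\<integral>w. f w \<partial>(dirac_mixture ?W W' p)) = (\<Sum>w\<in>W'. p w * f w)"
    if "f \<in> borel_measurable ?W" for f :: "_ \<Rightarrow> real"
    using integral_dirac_mixture(2)[OF W'(1,3) p(1) that] .
  have g1_p: "(\<Sum>w\<in>W'. p w * g1 \<theta> j w) = 0" if "j \<in> J'" for j
    using that J'(1) p(3)[of j] integral_p[OF g1, of j] by auto
  have g2_p: "(\<Sum>w\<in>W'. p w * g2 \<theta> k w) \<le> 0" if "k \<in> K'" for k
    using that K'(1) p(4)[of k] integral_p[OF g2, of k] by auto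
  have exists: "\<exists>\<phi> \<zeta> u v. ?opt \<phi> \<zeta> u v"
    using lp_value_le_one[OF Z mu W'(3) J'(2) K'(2) p(1,2) g1_p g2_p]
    by (intro lp_optimizer_exists[where \<beta> = 1] Z W'(3) J'(2) K'(2)
        integral_finite_discrete[OF Z mu])
  have upper: "?T \<le> ?LP"
  proof -
    \<comment> \<open>The full index sets are essential for this comparison: a mixture constrained
      only by \<open>J'\<close> and \<open>K'\<close> need not be admissible.\<close>
    have "?T \<le> restricted_discrepancy ?W ?Z (g1 \<theta>) (g2 \<theta>) (\<kappa> \<theta>) \<mu> W' J K"
      unfolding target_discrepancy_def restricted_discrepancy_def
      by (intro discrepancy_antimono restricted_measures_subset_admissible W' g1 g2)
    with certified show ?thesis by (simp add: column_certified_def)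
  qed
  have nonneg: "0 \<le> ?T"
    unfolding target_discrepancy_def
    by (intro discrepancy_nonneg Z mu bind_in_space_prob_algebra[OF _ \<kappa>])
      (simp add: admissible_measures_def)
  have lower: "?LP + r_low \<le> ?T"
    if opt: "?opt \<phi> \<zeta> u v" and r: "r_low < \<infinity>"
      "r_low \<le> row_residual ?W ?Z (g1 \<theta>) (g2 \<theta>) (\<kappa> \<theta>) J' K' \<phi> \<zeta> u v" for \<phi> \<zeta> u v r_low
  proof -
    have le: "?LP \<le> ereal ((\<integral>z. \<phi> z \<partial>\<mu>) - \<zeta>)"
      using J' K' by (intro restricted_discrepancy_le_lp_value[OF Z \<kappa> W'(1,3) _ _ _ _ opt] g1 g2) auto
    show ?thesis
    proof (cases r_low)
      \<comment> \<open>A finite \<open>r_low\<close> is a uniform lower bound of the slack, so weak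
        duality applies with \<open>r = s\<close>.\<close>
      case (real s)
      have "s \<le> slack ?Z (g1 \<theta>) (g2 \<theta>) (\<kappa> \<theta>) J' K' \<phi> \<zeta> u v w" if "w \<in> space ?W" for w
        using r(2) that unfolding row_residual_def real by (simp add: le_INF_iff)
      moreover have "\<phi> \<in> space ?Z \<rightarrow>\<^sub>E {0..1}" "\<And>k. k \<in> K' \<Longrightarrow> 0 \<le> v k"
        using opt by (auto simp: lp_optimizer_def lp_feasible_def PiE_iff)
      ultimately have "ereal ((\<integral>z. \<phi> z \<partial>\<mu>) - \<zeta> + s) \<le> ?T"
        using J' K' by (intro lp_value_le_target_discrepancy[OF Z \<kappa>])
      moreover have "?LP + r_low \<le> ereal ((\<integral>z. \<phi> z \<partial>\<mu>) - \<zeta>) + ereal s"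
        unfolding real using le by (rule add_right_mono)
      ultimately show ?thesis by simp
    next
      case PInf
      with r(1) show ?thesis by simp
    next
      \<comment> \<open>Here \<open>?LP < \<infinity>\<close> matters, since \<open>\<infinity> + - \<infinity> = \<infinity>\<close> for extended reals.\<close>
      case MInf
      have "?LP \<noteq> \<infinity>" using le by auto
      with MInf show ?thesis by (cases ?LP) auto
    qed
  qed
  show ?thesis using exists upper nonneg lower by simp
qed

end
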